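(* Consider clouds of points $(x_i,y_i)$, $i=1,\dots,N$, in the plane with linear coefficients $M,H$, transformed under invertible matrices $A=\begin{pmatrix}\alpha&\beta\\ \gamma&\delta\end{pmatrix}$ with real entries, and let $\hat M=\mathcal{M}(M,H,\alpha,\beta,\gamma,\delta)$, $\hat H=\mathcal{H}(M,H,\alpha,\beta,\gamma,\delta)$ be the linear coefficients of the transformed cloud. Let $I:\mathbb{R}^2\to\mathbb{R}$ be a function such that $I(\hat M,\hat H)$ is analytic in the parameters $\alpha,\beta,\gamma,\delta$. Then $I$ is a cloud invariant if and only if the following four equations hold simultaneously (for every pair of values $M$, $H$): $$\xi^1_\alpha\frac{\partial I}{\partial M}+\xi^2_\alpha\frac{\partial I}{\partial H}=0,\quad \xi^1_\beta\frac{\partial I}{\partial M}+\xi^2_\beta\frac{\partial I}{\partial H}=0,\quad \xi^1_\gamma\frac{\partial I}{\partial M}+\xi^2_\gamma\frac{\partial I}{\partial H}=0,\quad \xi^1_\delta\frac{\partial I}{\partial M}+\xi^2_\delta\frac{\partial I}{\partial H}=0,$$ where, for $Q\in\{\alpha,\beta,\gamma,\delta\}$, $$\xi^1_Q=\frac{\partial\mathcal{M}}{\partial Q}(M,H,1,0,0,1),\qquad \xi^2_Q=\frac{\partial\mathcal{H}}{\partial Q}(M,H,1,0,0,1),$$ i.e. the partial derivatives of $\hat M$ and $\hat H$ with respect to $Q$ evaluated at $(\alpha,\beta,\gamma,\delta)=(1,0,0,1)$.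
   Context: A cloud of points is a finite family $(x_i,y_i)\in\mathbb{R}^2$, $i=1,\dots,N$. Its linear coefficients are $$M=\frac{N\sum_{i=1}^N x_iy_i-\sum_{i=1}^N x_i\sum_{i=1}^N y_i}{N\sum_{i=1}^N x_i^2-\left(\sum_{i=1}^N x_i\right)^2},\qquad H=\frac{N\sum_{i=1}^N y_i^2-\left(\sum_{i=1}^N y_i\right)^2}{N\sum_{i=1}^N x_i^2-\left(\sum_{i=1}^N x_i\right)^2},$$ understood to be defined (nonzero denominator) whenever mentioned. The transformation of the cloud under a $2\times2$ matrix $A$ is the cloud $(\hat x_i,\hat y_i)$ with $\begin{pmatrix}\hat x_i\\ \hat y_i\end{pmatrix}=A\begin{pmatrix}x_i\\ y_i\end{pmatrix}$. For $A=\begin{pmatrix}\alpha&\beta\\ \gamma&\delta\end{pmatrix}$ the linear coefficients of the transformed cloud are $$\hat M=\mathcal{M}(M,H,\alpha,\beta,\gamma,\delta)=\frac{(\alpha\delta+\beta\gamma)M+\beta\delta H+\alpha\gamma}{2\alpha\beta M+\beta^2H+\alpha^2},\qquad \hat H=\mathcal{H}(M,H,\alpha,\beta,\gamma,\delta)=\frac{2\gamma\delta M+\delta^2H+\gamma^2}{2\alpha\beta M+\beta^2H+\alpha^2}.$$ A function $I:\mathbb{R}^2\to\mathbb{R}$ is a cloud invariant (for a given set of matrices; here all invertible real $2\times2$ matrices) if $I(\hat M,\hat H)=I(M,H)$ for every cloud and every matrix $A$ of the set, whenever both pairs of linear coefficients are defined.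
   Formalization: I is additionally assumed differentiable at every pair (M,H) with H = M² (collinear clouds), since otherwise the partials may not exist or the equations may fail for an invariant; "every pair of values M, H" means every pair of linear coefficients of some cloud. *)

theory Defs
  imports "HOL-Analysis.Analysis"
begin

text \<open>
  A cloud of \<open>N\<close> points is a family \<open>p 1, \<dots>, p N\<close> of vectors in \<open>real^2\<close>;
  the values of \<open>p\<close> outside \<open>{1..N}\<close> are irrelevant.
\<close>

definition cloud_den :: "nat \<Rightarrow> (nat \<Rightarrow> real^2) \<Rightarrow> real" where
  "cloud_den N p = real N * (\<Sum>i=1..N. (p i $ 1)\<^sup>2) - (\<Sum>i=1..N. p i $ 1)\<^sup>2"

definition coeff_M :: "nat \<Rightarrow> (nat \<Rightarrow> real^2) \<Rightarrow> real" where
  "coeff_M N p = (real N * (\<Sum>i=1..N. p i $ 1 * p i $ 2)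
      - (\<Sum>i=1..N. p i $ 1) * (\<Sum>i=1..N. p i $ 2)) / cloud_den N p"

definition coeff_H :: "nat \<Rightarrow> (nat \<Rightarrow> real^2) \<Rightarrow> real" where
  "coeff_H N p = (real N * (\<Sum>i=1..N. (p i $ 2)\<^sup>2) - (\<Sum>i=1..N. p i $ 2)\<^sup>2) / cloud_den N p"

definition transform_cloud :: "real^2^2 \<Rightarrow> (nat \<Rightarrow> real^2) \<Rightarrow> nat \<Rightarrow> real^2" where
  "transform_cloud A p = (\<lambda>i. A *v p i)"

definition linear_coeff_pairs :: "(real \<times> real) set" where
  "linear_coeff_pairs = {(coeff_M N p, coeff_H N p) | N p. cloud_den N p \<noteq> 0}"

definition cloud_invariant :: "(real^2^2) set \<Rightarrow> (real \<times> real \<Rightarrow> real) \<Rightarrow> bool" where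
  "cloud_invariant S I \<longleftrightarrow>
    (\<forall>N p. \<forall>A\<in>S. cloud_den N p \<noteq> 0 \<longrightarrow> cloud_den N (transform_cloud A p) \<noteq> 0 \<longrightarrow>
      I (coeff_M N (transform_cloud A p), coeff_H N (transform_cloud A p))
        = I (coeff_M N p, coeff_H N p))"

definition hat_den :: "real \<Rightarrow> real \<Rightarrow> real \<Rightarrow> real \<Rightarrow> real" where
  "hat_den M H \<alpha> \<beta> = 2 * \<alpha> * \<beta> * M + \<beta>\<^sup>2 * H + \<alpha>\<^sup>2"

definition hat_M :: "real \<Rightarrow> real \<Rightarrow> real \<Rightarrow> real \<Rightarrow> real \<Rightarrow> real \<Rightarrow> real" where
  "hat_M M H \<alpha> \<beta> \<gamma> \<delta> =
    ((\<alpha> * \<delta> + \<beta> * \<gamma>) * M + \<beta> * \<delta> * H + \<alpha> * \<gamma>) / hat_den M H \<alpha> \<beta>"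

definition hat_H :: "real \<Rightarrow> real \<Rightarrow> real \<Rightarrow> real \<Rightarrow> real \<Rightarrow> real \<Rightarrow> real" where
  "hat_H M H \<alpha> \<beta> \<gamma> \<delta> =
    (2 * \<gamma> * \<delta> * M + \<delta>\<^sup>2 * H + \<gamma>\<^sup>2) / hat_den M H \<alpha> \<beta>"

text \<open>
  The partial derivatives, at \<open>(\<alpha>, \<beta>, \<gamma>, \<delta>) = (1, 0, 0, 1)\<close>, of a function of the entries
  of the matrix.
\<close>

definition d_alpha :: "(real \<Rightarrow> real \<Rightarrow> real \<Rightarrow> real \<Rightarrow> real) \<Rightarrow> real" where
  "d_alpha f = deriv (\<lambda>\<alpha>. f \<alpha> 0 0 1) 1"

definition d_beta :: "(real \<Rightarrow> real \<Rightarrow> real \<Rightarrow> real \<Rightarrow> real) \<Rightarrow> real" where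
  "d_beta f = deriv (\<lambda>\<beta>. f 1 \<beta> 0 1) 0"

definition d_gamma :: "(real \<Rightarrow> real \<Rightarrow> real \<Rightarrow> real \<Rightarrow> real) \<Rightarrow> real" where
  "d_gamma f = deriv (\<lambda>\<gamma>. f 1 0 \<gamma> 1) 0"

definition d_delta :: "(real \<Rightarrow> real \<Rightarrow> real \<Rightarrow> real \<Rightarrow> real) \<Rightarrow> real" where
  "d_delta f = deriv (\<lambda>\<delta>. f 1 0 0 \<delta>) 1"

definition partial_M :: "(real \<times> real \<Rightarrow> real) \<Rightarrow> real \<Rightarrow> real \<Rightarrow> real" where
  "partial_M I M H = deriv (\<lambda>m. I (m, H)) M"

definition partial_H :: "(real \<times> real \<Rightarrow> real) \<Rightarrow> real \<Rightarrow> real \<Rightarrow> real" where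
  "partial_H I M H = deriv (\<lambda>h. I (M, h)) H"

text \<open>
  Real analyticity at a point: near \<open>a\<close>, the function is the sum of a power series in the
  coordinates of \<open>x - a\<close>. Multi-indices are the functions from \<open>Basis\<close> to \<open>nat\<close>, made
  extensional so that each occurs once; \<open>has_sum\<close> over them is absolute convergence.
  On \<open>real^2^2\<close> the coordinates are the four entries of the matrix.
\<close>

definition real_analytic_at :: "('a::euclidean_space \<Rightarrow> real) \<Rightarrow> 'a \<Rightarrow> bool" where
  "real_analytic_at f a \<longleftrightarrow>
    (\<exists>(c :: ('a \<Rightarrow> nat) \<Rightarrow> real) r. r > 0 \<and>
      (\<forall>x\<in>ball a r.
        ((\<lambda>k. c k * (\<Prod>b\<in>Basis. ((x - a) \<bullet> b) ^ k b)) has_sum f x) (Basis \<rightarrow>\<^sub>E UNIV)))"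

text \<open>
  The closed formulas are the linear coefficients of the transformed cloud, and \<open>hat_den\<close>
  vanishes exactly when these are undefined.
\<close>

lemma cloud_den_transform:
  assumes "cloud_den N p \<noteq> 0"
  shows "cloud_den N (transform_cloud A p)
    = cloud_den N p * hat_den (coeff_M N p) (coeff_H N p) (A $ 1 $ 1) (A $ 1 $ 2)"
proof -
  define X Y Z U V where defs: "X = (\<Sum>i=1..N. p i $ 1)" "Y = (\<Sum>i=1..N. p i $ 2)"
    "Z = (\<Sum>i=1..N. p i $ 1 * p i $ 2)" "U = (\<Sum>i=1..N. (p i $ 1)\<^sup>2)" "V = (\<Sum>i=1..N. (p i $ 2)\<^sup>2)"
  define a b where ab: "a = A $ 1 $ 1" "b = A $ 1 $ 2"
  have 1: "(\<Sum>i=1..N. a * p i $ 1 + b * p i $ 2) = a * X + b * Y"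
    by (simp add: defs sum.distrib sum_distrib_left)
  have 2: "(\<Sum>i=1..N. (a * p i $ 1 + b * p i $ 2)\<^sup>2) = a\<^sup>2 * U + 2 * a * b * Z + b\<^sup>2 * V"
    unfolding defs sum_distrib_left sum.distrib[symmetric]
    by (rule sum.cong) (auto simp: power2_eq_square algebra_simps)
  define D where D: "D = cloud_den N p"
  have dd: "D = N * U - X\<^sup>2" by (simp add: D cloud_den_def defs)
  have "cloud_den N (transform_cloud A p)
      = N * (a\<^sup>2 * U + 2 * a * b * Z + b\<^sup>2 * V) - (a * X + b * Y)\<^sup>2"
    unfolding 1[symmetric] 2[symmetric]
    by (simp add: cloud_den_def transform_cloud_def matrix_vector_mult_def sum_2 ab)
  also have "\<dots> = D * hat_den (coeff_M N p) (coeff_H N p) a b"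
    using assms unfolding hat_den_def coeff_M_def coeff_H_def defs[symmetric] D[symmetric]
    by (simp add: field_simps) (simp add: dd algebra_simps power2_eq_square)
  finally show ?thesis by (simp add: ab D)
qed

lemma coeff_M_transform:
  assumes "cloud_den N p \<noteq> 0"
  shows "coeff_M N (transform_cloud A p)
    = hat_M (coeff_M N p) (coeff_H N p) (A $ 1 $ 1) (A $ 1 $ 2) (A $ 2 $ 1) (A $ 2 $ 2)"
proof -
  define X Y Z U V where defs: "X = (\<Sum>i=1..N. p i $ 1)" "Y = (\<Sum>i=1..N. p i $ 2)"
    "Z = (\<Sum>i=1..N. p i $ 1 * p i $ 2)" "U = (\<Sum>i=1..N. (p i $ 1)\<^sup>2)" "V = (\<Sum>i=1..N. (p i $ 2)\<^sup>2)"
  define a b c d where ab: "a = A $ 1 $ 1" "b = A $ 1 $ 2" "c = A $ 2 $ 1" "d = A $ 2 $ 2"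
  define D where D: "D = cloud_den N p"
  have 1: "(\<Sum>i=1..N. s * p i $ 1 + t * p i $ 2) = s * X + t * Y" for s t
    by (simp add: defs sum.distrib sum_distrib_left)
  have 2: "(\<Sum>i=1..N. (a * p i $ 1 + b * p i $ 2) * (c * p i $ 1 + d * p i $ 2))
      = a * c * U + (a * d + b * c) * Z + b * d * V"
    unfolding defs sum_distrib_left sum.distrib[symmetric]
    by (rule sum.cong) (auto simp: power2_eq_square algebra_simps)
  have dd: "D = N * U - X\<^sup>2" by (simp add: D cloud_den_def defs)
  have "coeff_M N (transform_cloud A p)
      = (N * (a * c * U + (a * d + b * c) * Z + b * d * V) - (a * X + b * Y) * (c * X + d * Y))
        / cloud_den N (transform_cloud A p)"
    unfolding 1[symmetric] 2[symmetric]
    by (simp add: coeff_M_def transform_cloud_def matrix_vector_mult_def sum_2 ab)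
  also have "N * (a * c * U + (a * d + b * c) * Z + b * d * V) - (a * X + b * Y) * (c * X + d * Y)
      = D * ((a * d + b * c) * coeff_M N p + b * d * coeff_H N p + a * c)"
    using assms unfolding coeff_M_def coeff_H_def defs[symmetric] D[symmetric]
    by (simp add: field_simps) (simp add: dd algebra_simps power2_eq_square)
  finally show ?thesis
    using assms by (simp add: cloud_den_transform hat_M_def D ab)
qed

lemma coeff_H_transform:
  assumes "cloud_den N p \<noteq> 0"
  shows "coeff_H N (transform_cloud A p)
    = hat_H (coeff_M N p) (coeff_H N p) (A $ 1 $ 1) (A $ 1 $ 2) (A $ 2 $ 1) (A $ 2 $ 2)"
proof -
  define X Y Z U V where defs: "X = (\<Sum>i=1..N. p i $ 1)" "Y = (\<Sum>i=1..N. p i $ 2)"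
    "Z = (\<Sum>i=1..N. p i $ 1 * p i $ 2)" "U = (\<Sum>i=1..N. (p i $ 1)\<^sup>2)" "V = (\<Sum>i=1..N. (p i $ 2)\<^sup>2)"
  define c d where cd: "c = A $ 2 $ 1" "d = A $ 2 $ 2"
  define D where D: "D = cloud_den N p"
  have 1: "(\<Sum>i=1..N. c * p i $ 1 + d * p i $ 2) = c * X + d * Y"
    by (simp add: defs sum.distrib sum_distrib_left)
  have 2: "(\<Sum>i=1..N. (c * p i $ 1 + d * p i $ 2)\<^sup>2) = c\<^sup>2 * U + 2 * c * d * Z + d\<^sup>2 * V"
    unfolding defs sum_distrib_left sum.distrib[symmetric]
    by (rule sum.cong) (auto simp: power2_eq_square algebra_simps)
  have dd: "D = N * U - X\<^sup>2" by (simp add: D cloud_den_def defs)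
  have "coeff_H N (transform_cloud A p)
      = (N * (c\<^sup>2 * U + 2 * c * d * Z + d\<^sup>2 * V) - (c * X + d * Y)\<^sup>2)
        / cloud_den N (transform_cloud A p)"
    unfolding 1[symmetric] 2[symmetric]
    by (simp add: coeff_H_def transform_cloud_def matrix_vector_mult_def sum_2 cd)
  also have "N * (c\<^sup>2 * U + 2 * c * d * Z + d\<^sup>2 * V) - (c * X + d * Y)\<^sup>2
      = D * (2 * c * d * coeff_M N p + d\<^sup>2 * coeff_H N p + c\<^sup>2)"
    using assms unfolding coeff_M_def coeff_H_def defs[symmetric] D[symmetric]
    by (simp add: field_simps) (simp add: dd algebra_simps power2_eq_square)
  finally show ?thesis
    using assms by (simp add: cloud_den_transform hat_H_def D cd)
qed

end

theory Submission
  imports Defs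
begin

text \<open>
  The linear coefficients fill \<open>{(M, H). H \<ge> M\<^sup>2}\<close>, on which the invertible matrices have two
  orbits: \<open>H > M\<^sup>2\<close>, reached from \<open>(0, 1)\<close> by lower triangular matrices, and the parabola
  \<open>H = M\<^sup>2\<close>, reached from \<open>(0, 0)\<close>. So an invariant is a function constant on each orbit, and
  differentiability on the parabola makes its gradient vanish there too. Conversely, the \<open>\<gamma>\<close> and
  \<open>\<delta>\<close> equations have determinant \<open>2 (H - M\<^sup>2)\<close>. They force the gradient to vanish above the
  parabola, while on it the \<open>\<gamma>\<close> equation says that the derivative along the parabola vanishes.
\<close>

section \<open>Analytic functions along coordinate directions\<close>

text \<open>On the line through \<open>a\<close> in direction \<open>b\<close>, monomials involving
  another coordinate vanish, which leaves an ordinary power series in \<open>t\<close>.\<close>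

lemma real_analytic_at_imp_differentiable_along_Basis:
  fixes f :: "'a::euclidean_space \<Rightarrow> real"
  assumes "real_analytic_at f a" and b: "b \<in> Basis"
  shows "(\<lambda>t. f (a + t *\<^sub>R b)) field_differentiable (at 0)"
proof -
  obtain c r where r: "r > 0" and sum: "\<And>x. x \<in> ball a r \<Longrightarrow>
      ((\<lambda>k. c k * (\<Prod>b\<in>Basis. ((x - a) \<bullet> b) ^ k b)) has_sum f x) (Basis \<rightarrow>\<^sub>E UNIV)"
    using assms(1) unfolding real_analytic_at_def by blast
  \<comment> \<open>\<open>e n\<close> is the multi-index of the pure \<open>n\<close>-th power of
    the coordinate along \<open>b\<close>.\<close>
  define e :: "nat \<Rightarrow> 'a \<Rightarrow> nat"
    where "e n = (\<lambda>b'\<in>Basis. if b' = b then n else 0)" for n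
  have inj: "inj e"
  proof (rule injI)
    fix m n assume "e m = e n"
    then have "e m b = e n b" by simp
    then show "m = n" using b by (simp add: e_def)
  qed
  have series: "(\<lambda>n. c (e n) * t ^ n) sums f (a + t *\<^sub>R b)" if t: "\<bar>t\<bar> < r" for t
  proof -
    let ?g = "\<lambda>k. c k * (\<Prod>b'\<in>Basis. (t *\<^sub>R b \<bullet> b') ^ k b')"
    have "a + t *\<^sub>R b \<in> ball a r"
      using t b by (simp add: dist_norm)
    from sum[OF this] have "(?g has_sum f (a + t *\<^sub>R b)) (Basis \<rightarrow>\<^sub>E UNIV)"
      by simp
    moreover have "?g k = 0" if k: "k \<in> (Basis \<rightarrow>\<^sub>E UNIV) - range e" for k
    proof -
      have "\<exists>b'\<in>Basis. b' \<noteq> b \<and> k b' \<noteq> 0"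
      proof (rule ccontr)
        assume "\<not> ?thesis"
        then have "k = e (k b)"
          using k by (auto simp: e_def fun_eq_iff restrict_def PiE_def extensional_def)
        then show False using k by blast
      qed
      then obtain b' where "b' \<in> Basis" "b' \<noteq> b" "k b' \<noteq> 0" by blast
      then have "(\<Prod>b'\<in>Basis. (t *\<^sub>R b \<bullet> b') ^ k b') = 0"
        using b by (auto intro!: prod_zero bexI[of _ b'] simp: inner_Basis)
      then show ?thesis by simp
    qed
    moreover have "range e \<subseteq> Basis \<rightarrow>\<^sub>E UNIV"
      by (auto simp: e_def)
    ultimately have "(?g has_sum f (a + t *\<^sub>R b)) (range e)"
      by (subst has_sum_cong_neutral[where T = "Basis \<rightarrow>\<^sub>E UNIV" and g = ?g]) auto
    then have "((?g \<circ> e) has_sum f (a + t *\<^sub>R b)) UNIV"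
      using has_sum_reindex[OF inj] by blast
    moreover have "?g \<circ> e = (\<lambda>n. c (e n) * t ^ n)"
    proof
      fix n
      have "(\<Prod>b'\<in>Basis. (t *\<^sub>R b \<bullet> b') ^ e n b') = (\<Prod>b'\<in>Basis. if b' = b then t ^ n else 1)"
        using b by (intro prod.cong) (auto simp: e_def inner_Basis)
      also have "\<dots> = t ^ n" using b by simp
      finally show "(?g \<circ> e) n = c (e n) * t ^ n" by simp
    qed
    ultimately show ?thesis
      by (intro has_sum_imp_sums) (simp only:)
  qed
  \<comment> \<open>Convergence at \<open>r / 2\<close> puts 0 strictly inside the disc of
    convergence, where termwise differentiation is allowed.\<close>
  have "summable (\<lambda>n. c (e n) * (r / 2) ^ n)"
    using series[of "r / 2"] r by (auto simp: sums_iff)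
  then have "((\<lambda>t. \<Sum>n. c (e n) * t ^ n) has_field_derivative (\<Sum>n. diffs (\<lambda>n. c (e n)) n * 0 ^ n)) (at 0)"
    using r by (intro termdiffs_strong) auto
  then have "((\<lambda>t. f (a + t *\<^sub>R b)) has_field_derivative (\<Sum>n. diffs (\<lambda>n. c (e n)) n * 0 ^ n)) (at 0)"
    by (rule has_field_derivative_transform_within_open[where S = "ball 0 r"])
      (use r series in \<open>auto simp: sums_iff\<close>)
  then show ?thesis
    unfolding field_differentiable_def by blast
qed

section \<open>Linear coefficients and the action of matrices on them\<close>

lemma cloud_den_nonneg: "cloud_den N p \<ge> 0"
  using sum_squared_le_sum_of_squares[of "\<lambda>i. p i $ 1" "{1..N}"]
  by (simp add: cloud_den_def mult.commute)

text \<open>\<open>hat_den\<close> is the quotient of the transformed \<open>cloud_den\<close> by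
  the original one, and both are nonnegative by Cauchy-Schwarz.\<close>

lemma hat_den_nonneg:
  assumes "(M, H) \<in> linear_coeff_pairs"
  shows "hat_den M H \<alpha> \<beta> \<ge> 0"
proof -
  obtain N p where p: "M = coeff_M N p" "H = coeff_H N p" "cloud_den N p \<noteq> 0"
    using assms by (auto simp: linear_coeff_pairs_def)
  let ?A = "vector [vector [\<alpha>, \<beta>], 0] :: real^2^2"
  have "0 \<le> cloud_den N p * hat_den M H \<alpha> \<beta>"
    using cloud_den_nonneg[of N "transform_cloud ?A p"] p by (simp add: cloud_den_transform)
  then show ?thesis
    using p(3) cloud_den_nonneg[of N p] by (simp add: zero_le_mult_iff)
qed

lemma linear_coeff_pairs_iff: "(M, H) \<in> linear_coeff_pairs \<longleftrightarrow> M\<^sup>2 \<le> H"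
proof
  assume "(M, H) \<in> linear_coeff_pairs"
  \<comment> \<open>With \<alpha> = -M and \<beta> = 1, \<open>hat_den\<close> becomes
    \<open>H - M\<^sup>2\<close>.\<close>
  from hat_den_nonneg[OF this, of "- M" 1] show "M\<^sup>2 \<le> H"
    by (simp add: hat_den_def power2_eq_square)
next
  assume le: "M\<^sup>2 \<le> H"
  define s where "s = sqrt (H - M\<^sup>2)"
  have s: "s\<^sup>2 = H - M\<^sup>2" using le by (simp add: s_def)
  \<comment> \<open>Four points symmetric about the origin, so both coordinate sums vanish; the
    points (0, s) and (0, -s) raise the second moment of y from the collinear value to the one that
    \<open>H\<close> asks for.\<close>
  define p :: "nat \<Rightarrow> real^2" where
    "p i = (if i = 1 then vector [1, M] else if i = 2 then vector [-1, -M]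
      else if i = 3 then vector [0, s] else vector [0, -s])" for i
  have "{1..4} = {1, 2, 3, 4::nat}" by auto
  then have "cloud_den 4 p = 8" "coeff_M 4 p = M" "coeff_H 4 p = H"
    using s by (simp_all add: coeff_M_def coeff_H_def cloud_den_def p_def)
  then show "(M, H) \<in> linear_coeff_pairs"
    unfolding linear_coeff_pairs_def by force
qed

text \<open>The transformed coefficients depend on the cloud only through (M, H), so clouds can be
  replaced by the pairs that they realise.\<close>

lemma cloud_invariant_iff:
  "cloud_invariant S I \<longleftrightarrow>
    (\<forall>M H. \<forall>A\<in>S. M\<^sup>2 \<le> H \<longrightarrow> hat_den M H (A $ 1 $ 1) (A $ 1 $ 2) \<noteq> 0 \<longrightarrow>
      I (hat_M M H (A $ 1 $ 1) (A $ 1 $ 2) (A $ 2 $ 1) (A $ 2 $ 2),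
         hat_H M H (A $ 1 $ 1) (A $ 1 $ 2) (A $ 2 $ 1) (A $ 2 $ 2)) = I (M, H))"
  (is "_ \<longleftrightarrow> ?R")
proof
  assume inv: "cloud_invariant S I"
  show ?R
  proof (intro allI ballI impI)
    fix M H A
    assume A: "A \<in> S" and "M\<^sup>2 \<le> H" and den: "hat_den M H (A $ 1 $ 1) (A $ 1 $ 2) \<noteq> 0"
    then obtain N p where p: "M = coeff_M N p" "H = coeff_H N p" "cloud_den N p \<noteq> 0"
      unfolding linear_coeff_pairs_iff[symmetric] by (auto simp: linear_coeff_pairs_def)
    have "cloud_den N (transform_cloud A p) \<noteq> 0"
      using p den by (simp add: cloud_den_transform)
    then have "I (coeff_M N (transform_cloud A p), coeff_H N (transform_cloud A p)) = I (M, H)"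
      using inv A p unfolding cloud_invariant_def by blast
    then show "I (hat_M M H (A $ 1 $ 1) (A $ 1 $ 2) (A $ 2 $ 1) (A $ 2 $ 2),
         hat_H M H (A $ 1 $ 1) (A $ 1 $ 2) (A $ 2 $ 1) (A $ 2 $ 2)) = I (M, H)"
      using p by (simp add: coeff_M_transform coeff_H_transform)
  qed
next
  assume R: ?R
  show "cloud_invariant S I"
    unfolding cloud_invariant_def
  proof (intro allI ballI impI)
    fix N p A
    assume A: "A \<in> S" and p: "cloud_den N p \<noteq> 0" "cloud_den N (transform_cloud A p) \<noteq> 0"
    have "(coeff_M N p)\<^sup>2 \<le> coeff_H N p"
      unfolding linear_coeff_pairs_iff[symmetric] using p(1) by (auto simp: linear_coeff_pairs_def)
    with R A p
    show "I (coeff_M N (transform_cloud A p), coeff_H N (transform_cloud A p))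
        = I (coeff_M N p, coeff_H N p)"
      by (simp add: coeff_M_transform coeff_H_transform cloud_den_transform)
  qed
qed

text \<open>For a cloud, \<open>H - M\<^sup>2\<close> is the determinant of the scatter matrix over
  the square of its first entry; a transformation multiplies the determinant by the square of det A
  and that entry by \<open>hat_den\<close>.\<close>

lemma hat_H_minus_hat_M_squared:
  assumes "hat_den M H \<alpha> \<beta> \<noteq> 0"
  shows "hat_H M H \<alpha> \<beta> \<gamma> \<delta> - (hat_M M H \<alpha> \<beta> \<gamma> \<delta>)\<^sup>2
    = (\<alpha> * \<delta> - \<beta> * \<gamma>)\<^sup>2 * (H - M\<^sup>2) / (hat_den M H \<alpha> \<beta>)\<^sup>2"
proof -
  have "hat_H M H \<alpha> \<beta> \<gamma> \<delta> - (hat_M M H \<alpha> \<beta> \<gamma> \<delta>)\<^sup>2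
      = ((2 * \<gamma> * \<delta> * M + \<delta>\<^sup>2 * H + \<gamma>\<^sup>2) * hat_den M H \<alpha> \<beta>
        - ((\<alpha> * \<delta> + \<beta> * \<gamma>) * M + \<beta> * \<delta> * H + \<alpha> * \<gamma>)\<^sup>2) / (hat_den M H \<alpha> \<beta>)\<^sup>2"
    using assms by (simp add: hat_H_def hat_M_def power_divide diff_divide_distrib power2_eq_square)
  also have "(2 * \<gamma> * \<delta> * M + \<delta>\<^sup>2 * H + \<gamma>\<^sup>2) * hat_den M H \<alpha> \<beta>
        - ((\<alpha> * \<delta> + \<beta> * \<gamma>) * M + \<beta> * \<delta> * H + \<alpha> * \<gamma>)\<^sup>2 = (\<alpha> * \<delta> - \<beta> * \<gamma>)\<^sup>2 * (H - M\<^sup>2)"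
    unfolding hat_den_def by algebra
  finally show ?thesis .
qed

section \<open>Equation coefficients and derivatives along curves\<close>

lemma d_gamma_hat_M: "d_gamma (hat_M M H) = 1"
  unfolding d_gamma_def hat_M_def hat_den_def
  by (rule DERIV_imp_deriv) (auto intro!: derivative_eq_intros)

lemma d_gamma_hat_H: "d_gamma (hat_H M H) = 2 * M"
  unfolding d_gamma_def hat_H_def hat_den_def
  by (rule DERIV_imp_deriv) (auto intro!: derivative_eq_intros)

lemma d_delta_hat_M: "d_delta (hat_M M H) = M"
  unfolding d_delta_def hat_M_def hat_den_def
  by (rule DERIV_imp_deriv) (auto intro!: derivative_eq_intros)

lemma d_delta_hat_H: "d_delta (hat_H M H) = 2 * H"
  unfolding d_delta_def hat_H_def hat_den_def
  by (rule DERIV_imp_deriv) (auto intro!: derivative_eq_intros)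

lemma has_derivative_imp_has_real_derivative_along_curve:
  assumes "(I has_derivative D) (at (g t))" and "(g has_vector_derivative v) (at t)"
  shows "((\<lambda>t. I (g t)) has_real_derivative D v) (at t)"
  using vector_derivative_diff_chain_within[OF assms(2) has_derivative_at_withinI[OF assms(1)]]
  by (simp add: o_def has_real_derivative_iff_has_vector_derivative)

lemma has_derivative_imp_partials:
  assumes D: "(I has_derivative D) (at (M, H))"
  shows "((\<lambda>m. I (m, H)) has_real_derivative D (1, 0)) (at M)"
    and "((\<lambda>h. I (M, h)) has_real_derivative D (0, 1)) (at H)"
    and "partial_M I M H = D (1, 0)" and "partial_H I M H = D (0, 1)"
proof -
  show M: "((\<lambda>m. I (m, H)) has_real_derivative D (1, 0)) (at M)"
    by (rule has_derivative_imp_has_real_derivative_along_curve[where g = "\<lambda>m. (m, H)" and I = I, OF D])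
      (auto intro!: has_vector_derivative_Pair derivative_eq_intros)
  show H: "((\<lambda>h. I (M, h)) has_real_derivative D (0, 1)) (at H)"
    by (rule has_derivative_imp_has_real_derivative_along_curve[where g = "\<lambda>h. (M, h)" and I = I, OF D])
      (auto intro!: has_vector_derivative_Pair derivative_eq_intros)
  show "partial_M I M H = D (1, 0)" "partial_H I M H = D (0, 1)"
    unfolding partial_M_def partial_H_def using M H by (auto intro: DERIV_imp_deriv)
qed

text \<open>The tangent vector (1, 2M) of the parabola consists of the coefficients of the \<gamma>
  equation.\<close>

lemma has_derivative_along_parabola:
  assumes D: "(I has_derivative D) (at (M, M\<^sup>2))"
  shows "((\<lambda>m. I (m, m\<^sup>2)) has_real_derivative D (1, 0) + 2 * M * D (0, 1)) (at M)"
proof -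
  have "((\<lambda>m. m\<^sup>2) has_real_derivative 2 * M) (at M)"
    by (auto intro!: derivative_eq_intros)
  then have "((\<lambda>m. (m, m\<^sup>2)) has_vector_derivative (1, 2 * M)) (at M)"
    unfolding has_real_derivative_iff_has_vector_derivative
    by (intro has_vector_derivative_Pair has_vector_derivative_id)
  then have "((\<lambda>m. I (m, m\<^sup>2)) has_real_derivative D (1, 2 * M)) (at M)"
    by (rule has_derivative_imp_has_real_derivative_along_curve[where g = "\<lambda>m. (m, m\<^sup>2)" and I = I, OF D])
  also have "D (1, 2 * M) = D (1, 0) + 2 * M * D (0, 1)"
    using has_derivative_linear[OF D] linear_add[of D "(1, 0)" "(2 * M) *\<^sub>R (0, 1)"]
      linear_cmul[of D "2 * M" "(0, 1)"] by simp
  finally show ?thesis .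
qed

section \<open>Gradients of functions constant on the orbits\<close>

lemma partials_zero_if_constant_above_parabola:
  assumes const: "\<And>m h. m\<^sup>2 < h \<Longrightarrow> I (m, h) = c" and MH: "M\<^sup>2 < H"
  shows "partial_M I M H = 0" "partial_H I M H = 0"
proof -
  have "open {m. m\<^sup>2 < H}" by (intro open_Collect_less continuous_intros)
  then have "((\<lambda>m. I (m, H)) has_real_derivative 0) (at M)"
    by (intro has_field_derivative_transform_within_open[OF DERIV_const]) (use const MH in auto)
  then show "partial_M I M H = 0" unfolding partial_M_def by (rule DERIV_imp_deriv)
  have "((\<lambda>h. I (M, h)) has_real_derivative 0) (at H)"
    by (intro has_field_derivative_transform_within_open[OF DERIV_const, where S = "{M\<^sup>2<..}"])
      (use const MH in auto)
  then show "partial_H I M H = 0" unfolding partial_H_def by (rule DERIV_imp_deriv)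
qed

text \<open>The tangential derivative is 0 by constancy on the parabola, and the vertical one is 0
  by constancy above it; the two directions span the plane.\<close>

lemma partials_zero_on_parabola:
  assumes diff: "I differentiable (at (M, M\<^sup>2))"
    and above: "\<And>m h. m\<^sup>2 < h \<Longrightarrow> I (m, h) = c" and on: "\<And>m. I (m, m\<^sup>2) = c'"
  shows "partial_M I M (M\<^sup>2) = 0" "partial_H I M (M\<^sup>2) = 0"
proof -
  obtain D where D: "(I has_derivative D) (at (M, M\<^sup>2))"
    using diff unfolding differentiable_def by blast
  have "((\<lambda>m. I (m, m\<^sup>2)) has_real_derivative 0) (at M)"
    by (simp add: on)
  from DERIV_unique[OF this has_derivative_along_parabola[OF D]]
  have par: "D (1, 0) + 2 * M * D (0, 1) = 0" by simp
  have der: "((\<lambda>h. I (M, h)) has_real_derivative D (0, 1)) (at (M\<^sup>2))"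
    using D by (rule has_derivative_imp_partials)
  have ev: "\<forall>\<^sub>F h in at_right (M\<^sup>2). I (M, h) = c"
    by (auto simp: eventually_at_filter above)
  have "((\<lambda>h. I (M, h)) \<longlongrightarrow> I (M, M\<^sup>2)) (at_right (M\<^sup>2))"
    using DERIV_isCont[OF der] by (simp add: isCont_def filterlim_at_split)
  moreover have "((\<lambda>h. I (M, h)) \<longlongrightarrow> c) (at_right (M\<^sup>2))"
    by (rule tendsto_eventually[OF ev])
  \<comment> \<open>Continuity at the boundary forces the two constants to agree.\<close>
  ultimately have c: "I (M, M\<^sup>2) = c"
    using tendsto_unique trivial_limit_at_right_real by blast
  \<comment> \<open>The quotient is taken from the right, since nothing is known about
    \<open>I\<close> below the parabola.\<close>
  have "((\<lambda>h. I (M, h)) has_real_derivative D (0, 1)) (at (M\<^sup>2) within {M\<^sup>2<..})"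
    using der by (rule has_field_derivative_at_within)
  then have "((\<lambda>h. (I (M, h) - c) / (h - M\<^sup>2)) \<longlongrightarrow> D (0, 1)) (at_right (M\<^sup>2))"
    by (simp add: has_field_derivative_iff c)
  moreover have "((\<lambda>h. (I (M, h) - c) / (h - M\<^sup>2)) \<longlongrightarrow> 0) (at_right (M\<^sup>2))"
    by (rule tendsto_eventually) (use ev in \<open>auto elim: eventually_mono\<close>)
  ultimately have "D (0, 1) = 0"
    using tendsto_unique trivial_limit_at_right_real by blast
  with par show "partial_M I M (M\<^sup>2) = 0" "partial_H I M (M\<^sup>2) = 0"
    by (simp_all add: has_derivative_imp_partials(3,4)[OF D])
qed

section \<open>Constancy above the parabola from vanishing partial derivatives\<close>

lemma field_differentiable_translate_iff:
  fixes f :: "'a::real_normed_field \<Rightarrow> 'a"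
  shows "(\<lambda>t. f (x + t)) field_differentiable (at 0) \<longleftrightarrow> f field_differentiable (at x)"
  using DERIV_shift[of f _ 0 x] by (simp add: field_differentiable_def add.commute)

lemma invertible_2_iff:
  fixes A :: "real^2^2"
  shows "invertible A \<longleftrightarrow> A $ 1 $ 1 * A $ 2 $ 2 - A $ 1 $ 2 * A $ 2 $ 1 \<noteq> 0"
  by (simp add: invertible_det_nz det_2)

text \<open>
  The coordinates \<open>\<gamma>\<close>, \<open>\<delta>\<close> with \<open>(M, H) = (\<gamma>, \<delta>\<^sup>2 + \<gamma>\<^sup>2)\<close> parametrize the orbit of \<open>(0, 1)\<close>.
\<close>

lemma field_differentiable_orbit_coordinates:
  fixes I :: "real \<times> real \<Rightarrow> real"
  assumes analytic: "\<And>A :: real^2^2. invertible A \<Longrightarrow> hat_den 0 1 (A $ 1 $ 1) (A $ 1 $ 2) \<noteq> 0 \<Longrightarrow>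
      real_analytic_at
        (\<lambda>B. I (hat_M 0 1 (B $ 1 $ 1) (B $ 1 $ 2) (B $ 2 $ 1) (B $ 2 $ 2),
                hat_H 0 1 (B $ 1 $ 1) (B $ 1 $ 2) (B $ 2 $ 1) (B $ 2 $ 2))) A"
    and "\<delta> \<noteq> 0"
  shows "(\<lambda>\<gamma>. I (\<gamma>, \<delta>\<^sup>2 + \<gamma>\<^sup>2)) field_differentiable (at \<gamma>)"
    and "(\<lambda>\<delta>. I (\<gamma>, \<delta>\<^sup>2 + \<gamma>\<^sup>2)) field_differentiable (at \<delta>)"
proof -
  define A :: "real^2^2" where "A = vector [vector [1, 0], vector [\<gamma>, \<delta>]]"
  have A: "A $ 1 $ 1 = 1" "A $ 1 $ 2 = 0" "A $ 2 $ 1 = \<gamma>" "A $ 2 $ 2 = \<delta>"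
    by (simp_all add: A_def)
  \<comment> \<open>These basis matrices vary one entry of the second row: \<open>j = 1\<close>
    moves \<gamma>, \<open>j = 2\<close> moves \<delta>.\<close>
  have E: "axis 2 (axis j 1) \<in> (Basis :: (real^2^2) set)" for j
    by (auto simp: Basis_vec_def)
  have *: "real_analytic_at
        (\<lambda>B. I (hat_M 0 1 (B $ 1 $ 1) (B $ 1 $ 2) (B $ 2 $ 1) (B $ 2 $ 2),
                hat_H 0 1 (B $ 1 $ 1) (B $ 1 $ 2) (B $ 2 $ 1) (B $ 2 $ 2))) A"
    using assms(2) by (intro analytic) (auto simp: A invertible_2_iff hat_den_def)
  show "(\<lambda>\<gamma>. I (\<gamma>, \<delta>\<^sup>2 + \<gamma>\<^sup>2)) field_differentiable (at \<gamma>)"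
    using real_analytic_at_imp_differentiable_along_Basis[OF * E[of 1]]
    by (subst field_differentiable_translate_iff[symmetric])
      (simp add: A axis_def hat_M_def hat_H_def hat_den_def)
  show "(\<lambda>\<delta>. I (\<gamma>, \<delta>\<^sup>2 + \<gamma>\<^sup>2)) field_differentiable (at \<delta>)"
    using real_analytic_at_imp_differentiable_along_Basis[OF * E[of 2]]
    by (subst field_differentiable_translate_iff[symmetric])
      (simp add: A axis_def hat_M_def hat_H_def hat_den_def)
qed

text \<open>
  Only separate differentiability in \<open>\<gamma>\<close> and \<open>\<delta>\<close> is available, so \<open>I\<close> is first shown to be
  independent of \<open>H\<close>; then \<open>\<partial>I/\<partial>M\<close> is the derivative along the translated parabola.
\<close>

lemma constant_above_parabola:
  fixes I :: "real \<times> real \<Rightarrow> real"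
  assumes diff_M: "\<And>m. (\<lambda>m. I (m, 1 + m\<^sup>2)) field_differentiable (at m)"
    and diff_H: "\<And>m \<delta>. \<delta> \<noteq> 0 \<Longrightarrow> (\<lambda>\<delta>. I (m, \<delta>\<^sup>2 + m\<^sup>2)) field_differentiable (at \<delta>)"
    and zero_M: "\<And>m h. m\<^sup>2 < h \<Longrightarrow> partial_M I m h = 0"
    and zero_H: "\<And>m h. m\<^sup>2 < h \<Longrightarrow> partial_H I m h = 0"
  obtains c where "\<And>m h. m\<^sup>2 < h \<Longrightarrow> I (m, h) = c"
proof -
  have "((\<lambda>h. I (m, h)) has_real_derivative 0) (at h)" if h: "m\<^sup>2 < h" for m h
  proof -
    \<comment> \<open>\<open>s\<close> is the orbit coordinate \<delta> of the point (m, h);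
      differentiability in \<delta> passes to \<open>h\<close> by the chain rule.\<close>
    define s where "s = sqrt (h - m\<^sup>2)"
    have s: "s > 0" using h by (simp add: s_def)
    then obtain d where d: "((\<lambda>\<delta>. I (m, \<delta>\<^sup>2 + m\<^sup>2)) has_real_derivative d) (at s)"
      using diff_H[of s m] by (auto simp: field_differentiable_def)
    have 1: "((\<lambda>h. sqrt (h - m\<^sup>2)) has_real_derivative inverse s / 2) (at h)"
      using h unfolding s_def by (auto intro!: derivative_eq_intros)
    have "((\<lambda>h. I (m, (sqrt (h - m\<^sup>2))\<^sup>2 + m\<^sup>2)) has_real_derivative d * (inverse s / 2)) (at h)"
      using d unfolding s_def by (rule DERIV_chain2) (use 1 in \<open>simp add: s_def\<close>)
    then have "((\<lambda>h. I (m, h)) has_real_derivative d * (inverse s / 2)) (at h)"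
      by (rule has_field_derivative_transform_within_open[where S = "{m\<^sup>2<..}"]) (use h in auto)
    \<comment> \<open>\<open>partial_H\<close> is a \<open>deriv\<close>, so its vanishing carries
      information only now that the derivative is known to exist.\<close>
    then show ?thesis
      using zero_H[OF h] DERIV_imp_deriv unfolding partial_H_def by metis
  qed
  then have "\<exists>c. \<forall>h\<in>{m\<^sup>2<..}. I (m, h) = c" for m
    by (intro has_field_derivative_zero_constant) (auto intro: has_field_derivative_at_within)
  then have indep: "I (m, h) = I (m, 1 + m\<^sup>2)" if "m\<^sup>2 < h" for m h
    using that by (metis greaterThan_iff less_add_same_cancel2 zero_less_one)
  have "((\<lambda>m. I (m, 1 + m\<^sup>2)) has_real_derivative 0) (at m)" for m
  proof -
    obtain d where d: "((\<lambda>m. I (m, 1 + m\<^sup>2)) has_real_derivative d) (at m)"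
      using diff_M by (auto simp: field_differentiable_def)
    \<comment> \<open>Near \<open>m\<close> the horizontal line at height
      \<open>1 + m\<^sup>2\<close> stays above the parabola, so independence of the height carries
      the derivative over to it.\<close>
    have "open {m'. m'\<^sup>2 < 1 + m\<^sup>2}" by (intro open_Collect_less continuous_intros)
    moreover have "I (m', 1 + m'\<^sup>2) = I (m', 1 + m\<^sup>2)" if "m' \<in> {m'. m'\<^sup>2 < 1 + m\<^sup>2}" for m'
      using that by (intro indep[symmetric]) simp
    ultimately have "((\<lambda>m'. I (m', 1 + m\<^sup>2)) has_real_derivative d) (at m)"
      by (intro has_field_derivative_transform_within_open[OF d, where S = "{m'. m'\<^sup>2 < 1 + m\<^sup>2}"])
        simp_all
    from DERIV_imp_deriv[OF this] have "d = 0"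
      using zero_M[of m "1 + m\<^sup>2"] by (simp add: partial_M_def)
    with d show ?thesis by simp
  qed
  then have "\<exists>c. \<forall>m\<in>UNIV. I (m, 1 + m\<^sup>2) = c"
    by (intro has_field_derivative_zero_constant) auto
  then obtain c where c: "\<And>m. I (m, 1 + m\<^sup>2) = c" by auto
  show thesis by (rule that[of c]) (rule trans[OF indep c])
qed

section \<open>Invariance as constancy on the two orbits\<close>

text \<open>A matrix with rows (1, 0) and (\<gamma>, \<delta>) sends (0, 1) to
  \<open>(\<gamma>, \<delta>\<^sup>2 + \<gamma>\<^sup>2)\<close> and (0, 0) to
  \<open>(\<gamma>, \<gamma>\<^sup>2)\<close>.\<close>

lemma cloud_invariant_imp_orbit_constant:
  assumes "cloud_invariant {A. invertible A} I"
  shows "m\<^sup>2 < h \<Longrightarrow> I (m, h) = I (0, 1)" and "I (m, m\<^sup>2) = I (0, 0)"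
proof -
  have low: "I (hat_M M H 1 0 \<gamma> \<delta>, hat_H M H 1 0 \<gamma> \<delta>) = I (M, H)"
    if "M\<^sup>2 \<le> H" "\<delta> \<noteq> 0" for M H \<gamma> \<delta>
  proof -
    define A :: "real^2^2" where "A = vector [vector [1, 0], vector [\<gamma>, \<delta>]]"
    have A: "A $ 1 $ 1 = 1" "A $ 1 $ 2 = 0" "A $ 2 $ 1 = \<gamma>" "A $ 2 $ 2 = \<delta>"
      by (simp_all add: A_def)
    have "invertible A" "hat_den M H (A $ 1 $ 1) (A $ 1 $ 2) \<noteq> 0"
      using that by (simp_all add: A invertible_2_iff hat_den_def)
    then show ?thesis
      using assms that unfolding cloud_invariant_iff A[symmetric] by blast
  qed
  show "I (m, h) = I (0, 1)" if "m\<^sup>2 < h"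
    using low[of 0 1 "sqrt (h - m\<^sup>2)" m] that by (simp add: hat_M_def hat_H_def hat_den_def)
  show "I (m, m\<^sup>2) = I (0, 0)"
    using low[of 0 0 1 m] by (simp add: hat_M_def hat_H_def hat_den_def)
qed

text \<open>An invertible matrix multiplies \<open>H - M\<^sup>2\<close> by a positive factor, so a
  pair never changes its orbit.\<close>

lemma orbit_constant_imp_cloud_invariant:
  assumes above: "\<And>m h. m\<^sup>2 < h \<Longrightarrow> I (m, h) = c" and on: "\<And>m. I (m, m\<^sup>2) = c'"
  shows "cloud_invariant {A. invertible A} I"
  unfolding cloud_invariant_iff
proof (intro allI ballI impI)
  fix M H :: real and A :: "real^2^2"
  assume A: "A \<in> {A. invertible A}" and le: "M\<^sup>2 \<le> H"
    and den: "hat_den M H (A $ 1 $ 1) (A $ 1 $ 2) \<noteq> 0"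
  let ?M = "hat_M M H (A $ 1 $ 1) (A $ 1 $ 2) (A $ 2 $ 1) (A $ 2 $ 2)"
  let ?H = "hat_H M H (A $ 1 $ 1) (A $ 1 $ 2) (A $ 2 $ 1) (A $ 2 $ 2)"
  note eq = hat_H_minus_hat_M_squared[OF den, of "A $ 2 $ 1" "A $ 2 $ 2"]
  show "I (?M, ?H) = I (M, H)"
  proof (cases "H = M\<^sup>2")
    case True
    then have "?H = ?M\<^sup>2" using eq by simp
    then show ?thesis using True on by simp
  next
    case False
    with le have less: "M\<^sup>2 < H" by simp
    then have "0 < ?H - ?M\<^sup>2"
      using A den unfolding eq by (simp add: invertible_2_iff)
    then show ?thesis using above less by simp
  qed
qed


section \<open>Equivalence of invariance and the four equations\<close>

text \<open>Pairs on the parabola are moved only within it, so analyticity there controls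
  \<open>I\<close> along the curve alone; \<open>differentiable_collinear\<close> links the partial
  derivatives to that curve.\<close>

theorem theorem3p1:
  fixes I :: "real \<times> real \<Rightarrow> real"
  assumes analytic: "\<And>M H (A :: real^2^2). (M, H) \<in> linear_coeff_pairs \<Longrightarrow> invertible A \<Longrightarrow>
      hat_den M H (A $ 1 $ 1) (A $ 1 $ 2) \<noteq> 0 \<Longrightarrow>
      real_analytic_at
        (\<lambda>B. I (hat_M M H (B $ 1 $ 1) (B $ 1 $ 2) (B $ 2 $ 1) (B $ 2 $ 2),
                hat_H M H (B $ 1 $ 1) (B $ 1 $ 2) (B $ 2 $ 1) (B $ 2 $ 2))) A"
    and differentiable_collinear:
      "\<And>M H. (M, H) \<in> linear_coeff_pairs \<Longrightarrow> H = M\<^sup>2 \<Longrightarrow> I differentiable (at (M, H))"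
  shows "cloud_invariant {A. invertible A} I \<longleftrightarrow>
    (\<forall>M H. (M, H) \<in> linear_coeff_pairs \<longrightarrow>
      d_alpha (hat_M M H) * partial_M I M H + d_alpha (hat_H M H) * partial_H I M H = 0 \<and>
      d_beta (hat_M M H) * partial_M I M H + d_beta (hat_H M H) * partial_H I M H = 0 \<and>
      d_gamma (hat_M M H) * partial_M I M H + d_gamma (hat_H M H) * partial_H I M H = 0 \<and>
      d_delta (hat_M M H) * partial_M I M H + d_delta (hat_H M H) * partial_H I M H = 0)"
proof
  assume inv: "cloud_invariant {A. invertible A} I"
  have "partial_M I M H = 0 \<and> partial_H I M H = 0" if MH: "(M, H) \<in> linear_coeff_pairs" for M H
  proof (cases "H = M\<^sup>2")
    case True
    then show ?thesis
      using partials_zero_on_parabola[of I M] cloud_invariant_imp_orbit_constant[OF inv]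
        differentiable_collinear[OF MH] by blast
  next
    case False
    then have "M\<^sup>2 < H" using MH by (simp add: linear_coeff_pairs_iff)
    then show ?thesis
      using partials_zero_if_constant_above_parabola[of I _ M H]
        cloud_invariant_imp_orbit_constant(1)[OF inv] by blast
  qed
  then show "\<forall>M H. (M, H) \<in> linear_coeff_pairs \<longrightarrow>
      d_alpha (hat_M M H) * partial_M I M H + d_alpha (hat_H M H) * partial_H I M H = 0 \<and>
      d_beta (hat_M M H) * partial_M I M H + d_beta (hat_H M H) * partial_H I M H = 0 \<and>
      d_gamma (hat_M M H) * partial_M I M H + d_gamma (hat_H M H) * partial_H I M H = 0 \<and>
      d_delta (hat_M M H) * partial_M I M H + d_delta (hat_H M H) * partial_H I M H = 0"
    by simp
next
  assume "\<forall>M H. (M, H) \<in> linear_coeff_pairs \<longrightarrow>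
      d_alpha (hat_M M H) * partial_M I M H + d_alpha (hat_H M H) * partial_H I M H = 0 \<and>
      d_beta (hat_M M H) * partial_M I M H + d_beta (hat_H M H) * partial_H I M H = 0 \<and>
      d_gamma (hat_M M H) * partial_M I M H + d_gamma (hat_H M H) * partial_H I M H = 0 \<and>
      d_delta (hat_M M H) * partial_M I M H + d_delta (hat_H M H) * partial_H I M H = 0"
  then have g: "partial_M I M H + 2 * M * partial_H I M H = 0"
    and d: "M * partial_M I M H + 2 * H * partial_H I M H = 0" if "M\<^sup>2 \<le> H" for M H
    using that unfolding linear_coeff_pairs_iff d_gamma_hat_M d_gamma_hat_H d_delta_hat_M d_delta_hat_H
    by auto
  have zero: "partial_M I M H = 0" "partial_H I M H = 0" if "M\<^sup>2 < H" for M H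
  proof -
    \<comment> \<open>Subtract \<open>M\<close> times the \<gamma> equation from the \<delta>
      equation.\<close>
    have "2 * (H - M\<^sup>2) * partial_H I M H = 0"
      using g[of M H] d[of M H] less_imp_le[OF that] by algebra
    then show "partial_H I M H = 0" using that by simp
    then show "partial_M I M H = 0" using g[of M H] that by simp
  qed
  have an: "real_analytic_at
        (\<lambda>B. I (hat_M 0 1 (B $ 1 $ 1) (B $ 1 $ 2) (B $ 2 $ 1) (B $ 2 $ 2),
                hat_H 0 1 (B $ 1 $ 1) (B $ 1 $ 2) (B $ 2 $ 1) (B $ 2 $ 2))) A"
    if "invertible A" "hat_den 0 1 (A $ 1 $ 1) (A $ 1 $ 2) \<noteq> 0" for A :: "real^2^2"
    using that by (intro analytic) (auto simp: linear_coeff_pairs_iff)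
  obtain c where above: "\<And>m h. m\<^sup>2 < h \<Longrightarrow> I (m, h) = c"
  proof (rule constant_above_parabola[of I])
    show "(\<lambda>m. I (m, 1 + m\<^sup>2)) field_differentiable (at m)" for m
      using field_differentiable_orbit_coordinates(1)[OF an, of 1 m] by simp
    show "(\<lambda>\<delta>. I (m, \<delta>\<^sup>2 + m\<^sup>2)) field_differentiable (at \<delta>)" if "\<delta> \<noteq> 0" for m \<delta>
      using field_differentiable_orbit_coordinates(2)[OF an] that by simp
  qed (use zero in auto)
  have "((\<lambda>m. I (m, m\<^sup>2)) has_real_derivative 0) (at m)" for m
  proof -
    obtain D where D: "(I has_derivative D) (at (m, m\<^sup>2))"
      using differentiable_collinear[of m "m\<^sup>2"]
      by (auto simp: linear_coeff_pairs_iff differentiable_def)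
    \<comment> \<open>The \<gamma> equation at \<open>H = M\<^sup>2\<close>.\<close>
    have "D (1, 0) + 2 * m * D (0, 1) = 0"
      using g[of m "m\<^sup>2"] by (simp add: has_derivative_imp_partials(3,4)[OF D])
    then show ?thesis using has_derivative_along_parabola[OF D] by simp
  qed
  then have "\<exists>c'. \<forall>m\<in>UNIV. I (m, m\<^sup>2) = c'"
    by (intro has_field_derivative_zero_constant) auto
  \<comment> \<open>The constants on the two orbits need not be compared.\<close>
  then show "cloud_invariant {A. invertible A} I"
    using orbit_constant_imp_cloud_invariant[of I c] above by blast
qed

end
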